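(* Let $a,b\ge1$ be integers, $m=2^a3^b-1$ and $p(a,b)=3m(m+1)+1$. Let $$F_7:=\{(0,2),(0,3),(1,0),(1,1),(2,4),(2,5)\}\subset\mathbb{Z}/3\mathbb{Z}\times\mathbb{Z}/6\mathbb{Z}.$$ Then $7\mid p(a,b)$ if and only if $(a\bmod 3,\;b\bmod 6)\in F_7$; exactly $|F_7|/18=1/3$ of the class pairs are forbidden.
   Context: A class pair is an element of $\mathbb{Z}/3\mathbb{Z}\times\mathbb{Z}/6\mathbb{Z}$; it is called forbidden if $7\mid p(a,b)$ for the exponents $(a,b)$ in that class pair. *)

theory Defs
  imports Complex_Main "HOL-Library.Numeral_Type"
begin

text \<open>
  The library's numeral types \<open>3\<close> and \<open>6\<close> carry arithmetic modulo 3 and 6, so they are the rings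
  Z/3Z and Z/6Z, and \<open>of_nat\<close> into them is reduction modulo 3 and 6.
\<close>

type_synonym class_pair = "3 \<times> 6"

definition class_of :: "nat \<Rightarrow> nat \<Rightarrow> class_pair" where
  "class_of a b = (of_nat a, of_nat b)"

definition m :: "nat \<Rightarrow> nat \<Rightarrow> int" where
  "m a b = 2 ^ a * 3 ^ b - 1"

definition p :: "nat \<Rightarrow> nat \<Rightarrow> int" where
  "p a b = 3 * m a b * (m a b + 1) + 1"

definition F7 :: "class_pair set" where
  "F7 = {(0, 2), (0, 3), (1, 0), (1, 1), (2, 4), (2, 5)}"

text \<open>Every class pair contains exponents \<open>a, b \<ge> 1\<close>, so the condition is never vacuous.\<close>

definition forbidden :: "class_pair \<Rightarrow> bool" where
  "forbidden c \<longleftrightarrow> (\<forall>a b. a \<ge> 1 \<and> b \<ge> 1 \<and> class_of a b = c \<longrightarrow> 7 dvd p a b)"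

end

theory Submission
  imports Defs "HOL-Number_Theory.Cong"
begin

text \<open>
  Put \<open>x = m + 1 = 2 ^ a * 3 ^ b\<close>, so that \<open>p a b = 3 x (x - 1) + 1\<close>.  Over the field with seven
  elements this quadratic has the roots 2 and 6.  Now 3 is a primitive root modulo 7 with
  \<open>3\<^sup>2 = 2\<close>, hence \<open>x = 3 ^ (2 a + b)\<close>; the roots being \<open>3\<^sup>2\<close> and \<open>3\<^sup>3\<close>, the prime 7 divides \<open>p a b\<close>
  exactly when \<open>2 a + b\<close> is 2 or 3 modulo 6.  This linear condition depends only on \<open>a\<close> modulo 3
  and \<open>b\<close> modulo 6, and for each of the three values of \<open>a\<close> it leaves two values of \<open>b\<close>: these six
  pairs are \<open>F7\<close>.

  For the count, every class pair is the class of some exponents \<open>a, b \<ge> 1\<close>, so the forbidden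
  pairs are exactly the elements of \<open>F7\<close>, six out of eighteen.
\<close>

lemma seven_dvd_quadratic_iff:
  fixes x :: int
  shows "7 dvd 3 * (x - 1) * x + 1 \<longleftrightarrow> x mod 7 = 2 \<or> x mod 7 = 6"
proof -
  define r where "r = x mod 7"
  have "[3 * (x - 1) * x + 1 = 3 * (r - 1) * r + 1] (mod 7)"
    unfolding r_def by (intro cong_add cong_mult cong_diff cong_refl) (simp_all add: cong_def)
  hence "7 dvd 3 * (x - 1) * x + 1 \<longleftrightarrow> 7 dvd 3 * (r - 1) * r + 1"
    by (rule cong_dvd_iff)
  moreover have "r \<in> {0, 1, 2, 3, 4, 5, 6}"
    unfolding r_def by auto
  ultimately show ?thesis
    unfolding r_def [symmetric] by auto
qed

text \<open>
  Modulo 7 both bases are powers of 3, which turns the product into a single power whose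
  exponent matters only modulo 6.
\<close>

lemma two_three_power_mod_seven:
  "(2 ^ a * 3 ^ b :: int) mod 7 = 3 ^ ((2 * a + b) mod 6) mod 7"
proof -
  have "[2 = 3 ^ 2 :: int] (mod 7)"
    by (simp add: cong_def)
  hence "[2 ^ a * 3 ^ b = (3 ^ 2) ^ a * 3 ^ b :: int] (mod 7)"
    by (intro cong_mult cong_pow cong_refl)
  also have "(3 ^ 2) ^ a * 3 ^ b = (3 :: int) ^ (6 * ((2 * a + b) div 6) + (2 * a + b) mod 6)"
    by (simp only: power_mult [symmetric] power_add [symmetric] mult_div_mod_eq)
  also have "\<dots> = (3 ^ 6) ^ ((2 * a + b) div 6) * 3 ^ ((2 * a + b) mod 6)"
    by (simp only: power_mult power_add)
  \<comment> \<open>Fermat: the order of 3 modulo 7 divides 6.\<close>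
  also have "[\<dots> = 1 ^ ((2 * a + b) div 6) * 3 ^ ((2 * a + b) mod 6) :: int] (mod 7)"
    by (intro cong_mult cong_pow cong_refl) (simp add: cong_def)
  finally show ?thesis
    by (simp add: cong_def)
qed

lemma seven_dvd_p_iff:
  "7 dvd p a b \<longleftrightarrow> (2 * a + b) mod 6 = 2 \<or> (2 * a + b) mod 6 = 3"
proof -
  define e where "e = (2 * a + b) mod 6"
  have "7 dvd p a b \<longleftrightarrow> (3 :: int) ^ e mod 7 = 2 \<or> (3 :: int) ^ e mod 7 = 6"
    using seven_dvd_quadratic_iff [of "2 ^ a * 3 ^ b"]
    by (simp add: p_def m_def two_three_power_mod_seven e_def)
  moreover have "e \<in> {0, 1, 2, 3, 4, 5}"
    unfolding e_def by auto
  ultimately show ?thesis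
    unfolding e_def [symmetric] by auto
qed

lemma class_of_mod: "class_of (a mod 3) (b mod 6) = class_of a b"
proof -
  have "(3 :: 3) = 0" and "(6 :: 6) = 0"
    by simp_all
  hence "(of_nat (3 * (a div 3) + a mod 3) :: 3) = of_nat (a mod 3)"
    and "(of_nat (6 * (b div 6) + b mod 6) :: 6) = of_nat (b mod 6)"
    by (simp_all only: of_nat_add of_nat_mult of_nat_numeral mult_zero_left add_0_left)
  thus ?thesis
    by (simp add: class_of_def)
qed

text \<open>
  Changing \<open>a\<close> by 3 changes \<open>2 a + b\<close> by 6, so both sides depend only on the residues of \<open>a\<close>
  modulo 3 and \<open>b\<close> modulo 6; the eighteen pairs of residues are then compared one by one.
\<close>

lemma class_of_in_F7_iff:
  "class_of a b \<in> F7 \<longleftrightarrow> (2 * a + b) mod 6 = 2 \<or> (2 * a + b) mod 6 = 3"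
proof -
  define r s where "r = a mod 3" and "s = b mod 6"
  have "(2 * a + b) mod 6 = (2 * r + s) mod 6"
    unfolding r_def s_def by (simp add: mult_mod_right mod_simps)
  moreover have "class_of a b = class_of r s"
    unfolding r_def s_def by (rule class_of_mod [symmetric])
  moreover have "class_of r s \<in> F7 \<longleftrightarrow> (2 * r + s) mod 6 = 2 \<or> (2 * r + s) mod 6 = 3"
  proof -
    have "r \<in> {0, 1, 2}"
      unfolding r_def by auto
    moreover have "s \<in> {0, 1, 2, 3, 4, 5}"
      unfolding s_def by auto
    ultimately show ?thesis
      by (elim insertE emptyE) (simp_all add: class_of_def F7_def)
  qed
  ultimately show ?thesis
    by simp
qed

lemma class_of_surj:
  obtains a b where "a \<ge> 1" and "b \<ge> 1" and "class_of a b = c"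
proof -
  obtain u v where c: "c = (u, v)" by (cases c)
  obtain i :: int where i: "u = of_int i" "0 \<le> i" by (cases u) auto
  obtain j :: int where j: "v = of_int j" "0 \<le> j" by (cases v) auto
  \<comment> \<open>Adding the moduli keeps the classes and makes both exponents positive.\<close>
  have "class_of (nat i + 3) (nat j + 6) = c"
    using i j by (simp add: c class_of_def)
  thus thesis
    by (intro that [of "nat i + 3" "nat j + 6"]) simp_all
qed

lemma forbidden_iff: "forbidden c \<longleftrightarrow> c \<in> F7"
proof -
  obtain a b where "a \<ge> 1" "b \<ge> 1" "class_of a b = c"
    by (rule class_of_surj)
  thus ?thesis
    unfolding forbidden_def seven_dvd_p_iff class_of_in_F7_iff [symmetric] by blast
qed

lemma card_F7: "card F7 = 6"
  by (simp add: F7_def)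

theorem theorem3p13:
  "(\<forall>a b :: nat. a \<ge> 1 \<and> b \<ge> 1 \<longrightarrow> (7 dvd p a b \<longleftrightarrow> class_of a b \<in> F7)) \<and>
   real (card {c. forbidden c}) / real CARD(class_pair) = real (card F7) / 18 \<and>
   real (card F7) / 18 = 1 / 3"
  by (simp add: seven_dvd_p_iff class_of_in_F7_iff forbidden_iff card_F7)

end
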